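(* Let $G$ be a locally compact group acting by automorphisms and vertex-transitively on a locally finite, infinite tree $X$. Let $L$ be a bi-infinite geodesic line in $X$, let $x$ be a vertex of $L$, and let $K=\operatorname{Stab}_G(x)$, a maximal compact subgroup of $G$. Let $T$ be a finite abelian group, $\alpha:G\times G\to T$ a normalized 2-cocycle with $\alpha|_{K\times K}=1$, $\widetilde G = G\times_\alpha T$ the associated central extension, and $\widetilde K = K\times_\alpha T$ the preimage of $K$ in $\widetilde G$. Assume that $K$ acts transitively on the visual boundary $\partial X$, and that there is an element $a\in G$ with $a(L)=L$ acting on $L$ as a translation of length $1$ (so that the orbit of $x$ under $A=\langle a\rangle$ is the vertex set of $L$). Then $(\widetilde G,\widetilde K)$ is a Gelfand pair.
   Context: A normalized 2-cocycle is a map $\alpha:G\times G\to T$ with $\alpha(g_1g_2,g_3)\alpha(g_1,g_2)=\alpha(g_1,g_2g_3)\alpha(g_2,g_3)$ and $\alpha(g,1)=\alpha(1,g)=1$. The group $\widetilde G=G\times_\alpha T$ is the set $G\times T$ with multiplication $(g_1,t_1)(g_2,t_2)=(g_1g_2,\alpha(g_1,g_2)t_1t_2)$. Standing conventions: $K$ is compact and open in $G$, the identity of $G$ has a neighborhood basis of compact open subgroups $U\le K$, and $\widetilde G$ is a locally compact topological group for the topology in which the sets $U\times\{1\}$, $U\le K$ compact open, form a neighborhood basis of the identity (so $\widetilde K\cong K\times T$ is compact and open in $\widetilde G$). The visual boundary $\partial X$ is the set of ends of $X$, i.e. endpoints at infinity of geodesic rays starting at a fixed vertex (independent of this vertex).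 For a locally compact group $H$ and a compact subgroup $C\le H$, the Hecke algebra $\mathscr H(H,C)$ is the space of continuous compactly supported $C$-bi-invariant functions on $H$ with convolution $(\psi*\phi)(x)=\int_H\psi(xg)\phi(g^{-1})\,dg$; $(H,C)$ is a Gelfand pair if $\mathscr H(H,C)$ is commutative. *)

theory Defs
  imports "HOL-Analysis.Analysis" "HOL-Algebra.Group_Action"
begin

section \<open>Trees and their ends\<close>

text \<open>
  A simple graph is a vertex set \<open>V\<close> with a symmetric irreflexive adjacency relation \<open>E\<close>; an
  undirected edge is thus represented by both of its orientations. The notion of tree in the AFP
  entry Graph\<open>_\<close>Theory excludes directed cycles, including those of length 2, and is therefore
  not the one needed here.
\<close>

definition simple_graph :: "'v set \<Rightarrow> ('v \<times> 'v) set \<Rightarrow> bool" where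
  "simple_graph V E \<longleftrightarrow> E \<subseteq> V \<times> V \<and> sym E \<and> irrefl E"

definition connected_graph :: "'v set \<Rightarrow> ('v \<times> 'v) set \<Rightarrow> bool" where
  "connected_graph V E \<longleftrightarrow> V \<noteq> {} \<and> (\<forall>u\<in>V. \<forall>v\<in>V. (u, v) \<in> E\<^sup>*)"

definition graph_cycle :: "('v \<times> 'v) set \<Rightarrow> 'v list \<Rightarrow> bool" where
  "graph_cycle E p \<longleftrightarrow>
     3 \<le> length p \<and> distinct p \<and>
     (\<forall>i. Suc i < length p \<longrightarrow> (p ! i, p ! Suc i) \<in> E) \<and> (last p, hd p) \<in> E"

definition tree :: "'v set \<Rightarrow> ('v \<times> 'v) set \<Rightarrow> bool" where
  "tree V E \<longleftrightarrow> simple_graph V E \<and> connected_graph V E \<and> (\<nexists>p. graph_cycle E p)"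

definition locally_finite_graph :: "'v set \<Rightarrow> ('v \<times> 'v) set \<Rightarrow> bool" where
  "locally_finite_graph V E \<longleftrightarrow> (\<forall>v\<in>V. finite {w. (v, w) \<in> E})"

text \<open>Only meaningful for vertices in the same connected component.\<close>

definition graph_dist :: "('v \<times> 'v) set \<Rightarrow> 'v \<Rightarrow> 'v \<Rightarrow> nat" where
  "graph_dist E u v = (LEAST n. (u, v) \<in> E ^^ n)"

definition geodesic_ray :: "'v set \<Rightarrow> ('v \<times> 'v) set \<Rightarrow> (nat \<Rightarrow> 'v) \<Rightarrow> bool" where
  "geodesic_ray V E r \<longleftrightarrow>
     range r \<subseteq> V \<and> (\<forall>i j. i \<le> j \<longrightarrow> graph_dist E (r i) (r j) = j - i)"

definition geodesic_line :: "'v set \<Rightarrow> ('v \<times> 'v) set \<Rightarrow> (int \<Rightarrow> 'v) \<Rightarrow> bool" where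
  "geodesic_line V E l \<longleftrightarrow>
     range l \<subseteq> V \<and> (\<forall>i j. i \<le> j \<longrightarrow> graph_dist E (l i) (l j) = nat (j - i))"

text \<open>
  A line is identified with its vertex set, so it carries no preferred parametrisation or
  direction; in particular a translation of length \<open>d\<close> may go in either direction.
\<close>

definition is_geodesic_line :: "'v set \<Rightarrow> ('v \<times> 'v) set \<Rightarrow> 'v set \<Rightarrow> bool" where
  "is_geodesic_line V E L \<longleftrightarrow> (\<exists>l. geodesic_line V E l \<and> L = range l)"

definition translates_line ::
    "'v set \<Rightarrow> ('v \<times> 'v) set \<Rightarrow> ('v \<Rightarrow> 'v) \<Rightarrow> 'v set \<Rightarrow> nat \<Rightarrow> bool" where
  "translates_line V E f L d \<longleftrightarrow>
     (\<exists>l. geodesic_line V E l \<and> L = range l \<and> (\<forall>n. f (l n) = l (n + int d)))"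

text \<open>Two rays of a tree have the same endpoint at infinity iff they share a common tail.\<close>

definition same_end :: "'v set \<Rightarrow> ('v \<times> 'v) set \<Rightarrow> ((nat \<Rightarrow> 'v) \<times> (nat \<Rightarrow> 'v)) set" where
  "same_end V E =
     {(r, s). geodesic_ray V E r \<and> geodesic_ray V E s \<and> (\<exists>m n. \<forall>k. r (m + k) = s (n + k))}"

definition visual_boundary :: "'v set \<Rightarrow> ('v \<times> 'v) set \<Rightarrow> (nat \<Rightarrow> 'v) set set" where
  "visual_boundary V E = {r. geodesic_ray V E r} // same_end V E"

text \<open>The map induced on ends by a vertex map: the class of \<open>r\<close> goes to the class of \<open>f \<circ> r\<close>.\<close>

definition boundary_map :: "('v \<Rightarrow> 'v) \<Rightarrow> (nat \<Rightarrow> 'v) set \<Rightarrow> (nat \<Rightarrow> 'v) set" where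
  "boundary_map f \<xi> = (\<lambda>r. f \<circ> r) ` \<xi>"

definition transitive_on_boundary ::
    "'v set \<Rightarrow> ('v \<times> 'v) set \<Rightarrow> 'g set \<Rightarrow> ('g \<Rightarrow> 'v \<Rightarrow> 'v) \<Rightarrow> bool" where
  "transitive_on_boundary V E H \<phi> \<longleftrightarrow>
     (\<forall>\<xi>\<in>visual_boundary V E. \<forall>\<eta>\<in>visual_boundary V E. \<exists>h\<in>H. boundary_map (\<phi> h) \<xi> = \<eta>)"

locale graph_automorphism_action = group_action G V \<phi>
  for G (structure) and V and E :: "('v \<times> 'v) set" and \<phi> +
  assumes preserves_edges:
    "\<lbrakk>g \<in> carrier G; u \<in> V; v \<in> V\<rbrakk> \<Longrightarrow> (\<phi> g u, \<phi> g v) \<in> E \<longleftrightarrow> (u, v) \<in> E"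


section \<open>Locally compact groups, Haar measure, Gelfand pairs\<close>

locale topological_group = group G
  for G (structure) and \<tau> +
  assumes topspace_eq: "topspace \<tau> = carrier G"
    and continuous_mult: "continuous_map (prod_topology \<tau> \<tau>) \<tau> (\<lambda>(x, y). x \<otimes> y)"
    and continuous_inv: "continuous_map \<tau> \<tau> (\<lambda>x. inv x)"

locale locally_compact_group = topological_group +
  assumes Hausdorff: "Hausdorff_space \<tau>"
    and locally_compact: "locally_compact_space \<tau>"

definition compact_open_subgroups :: "('g, 'm) monoid_scheme \<Rightarrow> 'g topology \<Rightarrow> 'g set set" where
  "compact_open_subgroups G \<tau> = {U. subgroup U G \<and> compactin \<tau> U \<and> openin \<tau> U}"

text \<open>
  The library's \<^const>\<open>neighbourhood_base_at\<close> does not say that every member of the family is a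
  neighbourhood of the point.
\<close>

definition neighbourhood_basis :: "'a topology \<Rightarrow> 'a \<Rightarrow> 'a set set \<Rightarrow> bool" where
  "neighbourhood_basis X x \<B> \<longleftrightarrow>
     (\<forall>B\<in>\<B>. \<exists>W. openin X W \<and> x \<in> W \<and> W \<subseteq> B) \<and> neighbourhood_base_at x (\<lambda>B. B \<in> \<B>) X"

text \<open>Left Haar measures: nonzero left-invariant Radon measures on the Borel sets.\<close>

definition left_haar_measure :: "('g, 'm) monoid_scheme \<Rightarrow> 'g topology \<Rightarrow> 'g measure \<Rightarrow> bool" where
  "left_haar_measure G \<tau> \<mu> \<longleftrightarrow>
     sets \<mu> = sets (sigma (topspace \<tau>) {U. openin \<tau> U}) \<and>
     emeasure \<mu> (space \<mu>) \<noteq> 0 \<and>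
     (\<forall>g\<in>carrier G. \<forall>A\<in>sets \<mu>. emeasure \<mu> (g <#\<^bsub>G\<^esub> A) = emeasure \<mu> A) \<and>
     (\<forall>C. compactin \<tau> C \<longrightarrow> emeasure \<mu> C < \<infinity>) \<and>
     (\<forall>A\<in>sets \<mu>. emeasure \<mu> A = (INF U\<in>{U. openin \<tau> U \<and> A \<subseteq> U}. emeasure \<mu> U)) \<and>
     (\<forall>U. openin \<tau> U \<longrightarrow> emeasure \<mu> U = (SUP C\<in>{C. compactin \<tau> C \<and> C \<subseteq> U}. emeasure \<mu> C))"

text \<open>
  Functions on the group are extensional, i.e. fixed outside the carrier, so that equality of
  elements of the Hecke algebra is equality of functions on the group.
\<close>

definition hecke_algebra ::
    "('g, 'm) monoid_scheme \<Rightarrow> 'g topology \<Rightarrow> 'g set \<Rightarrow> ('g \<Rightarrow> complex) set" where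
  "hecke_algebra G \<tau> C =
     {f \<in> extensional (carrier G).
        continuous_map \<tau> euclidean f \<and>
        compactin \<tau> (\<tau> closure_of {x \<in> carrier G. f x \<noteq> 0}) \<and>
        (\<forall>c\<in>C. \<forall>c'\<in>C. \<forall>x\<in>carrier G. f (c \<otimes>\<^bsub>G\<^esub> x \<otimes>\<^bsub>G\<^esub> c') = f x)}"

definition convolution ::
    "('g, 'm) monoid_scheme \<Rightarrow> 'g measure \<Rightarrow> ('g \<Rightarrow> complex) \<Rightarrow> ('g \<Rightarrow> complex) \<Rightarrow> 'g \<Rightarrow> complex" where
  "convolution G \<mu> \<psi> \<phi> =
     (\<lambda>x\<in>carrier G. \<integral>g. \<psi> (x \<otimes>\<^bsub>G\<^esub> g) * \<phi> (inv\<^bsub>G\<^esub> g) \<partial>\<mu>)"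

text \<open>
  The choice of Haar measure is immaterial: by Haar's theorem one exists on every locally compact
  group and is unique up to a positive scalar, which only rescales the convolution.
\<close>

definition gelfand_pair :: "('g, 'm) monoid_scheme \<Rightarrow> 'g topology \<Rightarrow> 'g set \<Rightarrow> bool" where
  "gelfand_pair G \<tau> C \<longleftrightarrow>
     locally_compact_group G \<tau> \<and> subgroup C G \<and> compactin \<tau> C \<and>
     (\<forall>\<mu>. left_haar_measure G \<tau> \<mu> \<longrightarrow>
        (\<forall>\<psi>\<in>hecke_algebra G \<tau> C. \<forall>\<phi>\<in>hecke_algebra G \<tau> C.
           convolution G \<mu> \<psi> \<phi> = convolution G \<mu> \<phi> \<psi>))"


section \<open>Central extensions defined by cocycles\<close>

definition normalized_2_cocycle ::
    "('g, 'm) monoid_scheme \<Rightarrow> ('t, 'n) monoid_scheme \<Rightarrow> ('g \<Rightarrow> 'g \<Rightarrow> 't) \<Rightarrow> bool" where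
  "normalized_2_cocycle G T \<alpha> \<longleftrightarrow>
     (\<forall>g\<in>carrier G. \<forall>h\<in>carrier G. \<alpha> g h \<in> carrier T) \<and>
     (\<forall>g1\<in>carrier G. \<forall>g2\<in>carrier G. \<forall>g3\<in>carrier G.
        \<alpha> (g1 \<otimes>\<^bsub>G\<^esub> g2) g3 \<otimes>\<^bsub>T\<^esub> \<alpha> g1 g2 = \<alpha> g1 (g2 \<otimes>\<^bsub>G\<^esub> g3) \<otimes>\<^bsub>T\<^esub> \<alpha> g2 g3) \<and>
     (\<forall>g\<in>carrier G. \<alpha> g \<one>\<^bsub>G\<^esub> = \<one>\<^bsub>T\<^esub> \<and> \<alpha> \<one>\<^bsub>G\<^esub> g = \<one>\<^bsub>T\<^esub>)"

definition cocycle_extension ::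
    "('g, 'm) monoid_scheme \<Rightarrow> ('t, 'n) monoid_scheme \<Rightarrow> ('g \<Rightarrow> 'g \<Rightarrow> 't) \<Rightarrow> ('g \<times> 't) monoid" where
  "cocycle_extension G T \<alpha> =
     \<lparr>carrier = carrier G \<times> carrier T,
      monoid.mult = (\<lambda>(g1, t1) (g2, t2). (g1 \<otimes>\<^bsub>G\<^esub> g2, \<alpha> g1 g2 \<otimes>\<^bsub>T\<^esub> t1 \<otimes>\<^bsub>T\<^esub> t2)),
      one = (\<one>\<^bsub>G\<^esub>, \<one>\<^bsub>T\<^esub>)\<rparr>"

end

theory Submission
  imports Defs
begin

text \<open>
  Functions bi-invariant under the full preimage of \<open>K\<close> factor through \<open>G\<close>, so the cocycle plays
  no role: by Gelfand's trick it suffices that \<open>inv g\<close> lies in \<open>K g K\<close> for every \<open>g\<close> in \<open>G\<close>.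
  Since every vertex of the tree has at least two neighbours, every vertex lies on a ray from \<open>x\<close>.
  An element of \<open>K\<close> that moves the end of one ray from \<open>x\<close> to the end of another moves the first
  ray pointwise onto the second, so \<open>K\<close> is transitive on spheres around \<open>x\<close>. As \<open>g x\<close> and
  \<open>inv g x\<close> have the same distance from \<open>x\<close>, some \<open>k\<close> in \<open>K\<close> maps the first to the second, and
  then \<open>g k g\<close> fixes \<open>x\<close>.
\<close>

section \<open>Distances in trees\<close>

text \<open>The premise says that some walk exists; only then is the \<open>LEAST\<close> in
  \<open>graph_dist\<close> attained.\<close>

lemma relpow_graph_dist: "(u, v) \<in> E\<^sup>* \<Longrightarrow> (u, v) \<in> E ^^ graph_dist E u v"
  unfolding graph_dist_def by (metis LeastI rtrancl_imp_relpow)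

lemma graph_dist_le: "(u, v) \<in> E ^^ n \<Longrightarrow> graph_dist E u v \<le> n"
  unfolding graph_dist_def by (rule Least_le)

lemma graph_dist_self [simp]: "graph_dist E u u = 0"
  using graph_dist_le[of u u 0 E] by simp

lemma graph_dist_triangle:
  assumes "(u, v) \<in> E\<^sup>*" "(v, w) \<in> E\<^sup>*"
  shows "graph_dist E u w \<le> graph_dist E u v + graph_dist E v w"
  using assms by (intro graph_dist_le) (auto simp: relpow_add intro: relpow_graph_dist)

lemma sym_relpow: "sym R \<Longrightarrow> (u, v) \<in> R ^^ n \<Longrightarrow> (v, u) \<in> R ^^ n"
proof (induction n arbitrary: v)
  case (Suc n)
  then obtain w where "(u, w) \<in> R ^^ n" "(w, v) \<in> R" by auto
  with Suc show ?case by (meson relpow_Suc_I2 symD)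
qed simp

lemma graph_dist_commute: "sym E \<Longrightarrow> graph_dist E u v = graph_dist E v u"
  unfolding graph_dist_def using sym_relpow[of E] by metis

lemma graph_dist_eq_0_iff: "(u, v) \<in> E\<^sup>* \<Longrightarrow> graph_dist E u v = 0 \<longleftrightarrow> u = v"
  using relpow_graph_dist[of u v E] by auto

context
  fixes V :: "'v set" and E :: "('v \<times> 'v) set"
  assumes tree: "tree V E"
begin

lemma tree_edges: "E \<subseteq> V \<times> V" and tree_sym: "sym E"
  and tree_rtrancl: "u \<in> V \<Longrightarrow> v \<in> V \<Longrightarrow> (u, v) \<in> E\<^sup>*"
  using tree by (auto simp: tree_def simple_graph_def connected_graph_def)

lemma tree_dist_neighbour:
  assumes "x \<in> V" "(u, v) \<in> E"
  shows "graph_dist E x v \<le> Suc (graph_dist E x u)"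
proof -
  have "(x, u) \<in> E ^^ graph_dist E x u"
    using assms tree_edges by (intro relpow_graph_dist tree_rtrancl) auto
  with assms(2) show ?thesis by (intro graph_dist_le) auto
qed

lemma tree_parent:
  assumes "x \<in> V" "v \<in> V" "graph_dist E x v = Suc n"
  obtains u where "(u, v) \<in> E" "graph_dist E x u = n"
proof -
  have "(x, v) \<in> E ^^ Suc n"
    using relpow_graph_dist[OF tree_rtrancl] assms by metis
  then obtain u where u: "(x, u) \<in> E ^^ n" "(u, v) \<in> E" by auto
  moreover have "graph_dist E x u = n"
    using graph_dist_le[OF u(1)] tree_dist_neighbour[OF assms(1) u(2)] assms(3) by simp
  ultimately show ?thesis using that by blast
qed

text \<open>View the tree as rooted at \<open>x\<close>, with levels given by distance. Join both
  ends of \<open>q\<close> to their parents: a common parent closes a cycle, and distinct parents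
  give a longer path of the same kind one level down. At level 0 both ends are \<open>x\<close>,
  against distinctness. Acyclicity enters the argument here.\<close>

lemma tree_no_detour:
  assumes "x \<in> V" "distinct q" "2 \<le> length q" "set q \<subseteq> V"
    "successively (\<lambda>u v. (u, v) \<in> E) q"
    "graph_dist E x (hd q) = n" "graph_dist E x (last q) = n"
    "\<forall>v\<in>set q. n \<le> graph_dist E x v"
  shows False
  using assms(2-)
proof (induction n arbitrary: q)
  case 0
  then have "q \<noteq> []" by auto
  then have "hd q \<in> V" "last q \<in> V" using 0(3) hd_in_set last_in_set by blast+
  with 0 have "hd q = last q"
    using assms(1) graph_dist_eq_0_iff[OF tree_rtrancl] by metis
  with 0 show False by (cases q) (auto split: if_splits)
next
  case (Suc n)
  then have ne: "q \<noteq> []" by auto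
  then have V: "hd q \<in> V" "last q \<in> V" using Suc.prems(3) hd_in_set last_in_set by blast+
  obtain u where u: "(u, hd q) \<in> E" "graph_dist E x u = n"
    using tree_parent[OF assms(1) V(1)] Suc by metis
  obtain w where w: "(w, last q) \<in> E" "graph_dist E x w = n"
    using tree_parent[OF assms(1) V(2)] Suc by metis
  have notin: "u \<notin> set q" "w \<notin> set q" using u w Suc.prems(7) by auto
  have w': "(last q, w) \<in> E" using w tree_sym by (auto dest: symD)
  show False
  proof (cases "u = w")
    \<comment> \<open>The common parent lies below every vertex of \<open>q\<close>, so it is new;
      as \<open>q\<close> has at least two vertices, the closed path has at least three.\<close>
    case True
    have "successively (\<lambda>u v. (u, v) \<in> E) (u # q)"
      using Suc.prems u ne by (cases q) auto
    then have "graph_cycle E (u # q)"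
      using Suc.prems notin ne w' True
      unfolding graph_cycle_def successively_conv_nth by auto
    then show False using tree by (auto simp: tree_def)
  next
    case False
    show False
    \<comment> \<open>Both new ends lie at level \<open>n\<close>, strictly below the old path, so
      the longer path is still distinct.\<close>
    proof (rule Suc.IH[of "u # q @ [w]"])
      show "successively (\<lambda>u v. (u, v) \<in> E) (u # q @ [w])"
        using Suc.prems(4) u(1) ne w' by (simp add: successively_append_iff successively_Cons)
      show "\<forall>v\<in>set (u # q @ [w]). n \<le> graph_dist E x v"
        using Suc.prems(7) u w by auto
    qed (use Suc.prems notin False u w tree_edges in auto)
  qed
qed

text \<open>A neighbour on the level of \<open>v\<close> would give the path \<open>[z, v]\<close>,
  and two different parents the path \<open>[u, v, w]\<close>; \<open>tree_no_detour\<close>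
  excludes both. The weak inequalities let the lemma be read in reverse: of two neighbours of
  \<open>v\<close>, at least one is farther from \<open>x\<close>.\<close>

lemma tree_parent_unique:
  assumes "x \<in> V" "(u, v) \<in> E" "(w, v) \<in> E" "graph_dist E x u \<le> graph_dist E x v"
    "graph_dist E x w \<le> graph_dist E x v"
  shows "u = w"
proof -
  have V: "u \<in> V" "v \<in> V" "w \<in> V" using assms tree_edges by auto
  have less: "graph_dist E x z < graph_dist E x v"
    if "(z, v) \<in> E" "graph_dist E x z \<le> graph_dist E x v" for z
  proof (rule ccontr)
    assume "\<not> ?thesis"
    moreover have "z \<noteq> v" using that tree by (auto simp: tree_def simple_graph_def irrefl_def)
    ultimately show False
      using tree_no_detour[of x "[z, v]" "graph_dist E x v"] that assms(1) tree_edges by auto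
  qed
  show ?thesis
  proof (rule ccontr)
    assume "u \<noteq> w"
    moreover have "graph_dist E x v \<le> Suc (graph_dist E x u)"
      "graph_dist E x v \<le> Suc (graph_dist E x w)"
      using tree_dist_neighbour assms by auto
    moreover have "(v, w) \<in> E" using assms tree_sym by (auto dest: symD)
    ultimately show False
      using tree_no_detour[of x "[u, v, w]" "graph_dist E x u"] less[of u] less[of w] assms V
      by auto
  qed
qed

section \<open>Geodesic rays and lines in a tree\<close>

lemma geodesic_rayI:
  assumes "x \<in> V" "\<And>i. r i \<in> V" "\<And>i. (r i, r (Suc i)) \<in> E" "\<And>i. graph_dist E x (r i) = i"
  shows "geodesic_ray V E r"
  unfolding geodesic_ray_def
proof (intro conjI allI impI)
  fix i j :: nat
  assume "i \<le> j"
  have "(r i, r (i + k)) \<in> E ^^ k" for k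
    by (induction k) (use assms(3) in auto)
  from this[of "j - i"] have "graph_dist E (r i) (r j) \<le> j - i"
    using \<open>i \<le> j\<close> by (intro graph_dist_le) auto
  moreover have "graph_dist E x (r j) \<le> graph_dist E x (r i) + graph_dist E (r i) (r j)"
    by (intro graph_dist_triangle tree_rtrancl assms)
  ultimately show "graph_dist E (r i) (r j) = j - i" using assms(4) by simp
qed (use assms in auto)

lemma geodesic_ray_edge:
  assumes "geodesic_ray V E r"
  shows "(r i, r (Suc i)) \<in> E"
proof -
  have "graph_dist E (r i) (r (Suc i)) = 1" "(r i, r (Suc i)) \<in> E\<^sup>*"
    using assms by (auto simp: geodesic_ray_def image_subset_iff intro!: tree_rtrancl)
  then show ?thesis using relpow_graph_dist by fastforce
qed

text \<open>Walk from \<open>x\<close> to \<open>y\<close> along a shortest path, then move away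
  from \<open>x\<close> forever; with two neighbours at each vertex the walk never gets
  stuck.\<close>

lemma geodesic_ray_through:
  assumes "x \<in> V" "y \<in> V" "\<And>v. v \<in> V \<Longrightarrow> \<exists>u w. u \<noteq> w \<and> (v, u) \<in> E \<and> (v, w) \<in> E"
  obtains r where "geodesic_ray V E r" "r 0 = x" "r (graph_dist E x y) = y"
proof -
  let ?d = "graph_dist E x"
  have "\<exists>w. (v, w) \<in> E \<and> ?d w = Suc (?d v)" if v: "v \<in> V" for v
  proof -
    obtain u w where uw: "u \<noteq> w" "(v, u) \<in> E" "(v, w) \<in> E" using assms(3) v by blast
    then have "(u, v) \<in> E" "(w, v) \<in> E" using tree_sym by (auto dest: symD)
    \<comment> \<open>By uniqueness of parents, \<open>u\<close> and \<open>w\<close> cannot both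
      fail to be farther from \<open>x\<close> than \<open>v\<close>; an edge adds at most one to
      the distance.\<close>
    then have "\<not> (?d u \<le> ?d v \<and> ?d w \<le> ?d v)" using tree_parent_unique assms(1) uw(1) by blast
    moreover have "?d u \<le> Suc (?d v)" "?d w \<le> Suc (?d v)"
      using tree_dist_neighbour assms(1) uw by auto
    ultimately show ?thesis using uw by (meson le_antisym not_less_eq_eq)
  qed
  then obtain c where c: "\<And>v. v \<in> V \<Longrightarrow> (v, c v) \<in> E \<and> ?d (c v) = Suc (?d v)" by metis
  have cV: "c v \<in> V" if "v \<in> V" for v using c[OF that] tree_edges by auto
  define n where "n = ?d y"
  have "(x, y) \<in> E ^^ n" unfolding n_def using assms by (intro relpow_graph_dist tree_rtrancl)
  then obtain f where f: "f 0 = x" "f n = y" "\<And>i. i < n \<Longrightarrow> (f i, f (Suc i)) \<in> E"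
    by (auto simp: relpow_fun_conv)
  \<comment> \<open>Up to index \<open>n\<close> this is the shortest path; afterwards
    \<open>c\<close>, a choice of a neighbour one step farther out, is iterated from
    \<open>y\<close>.\<close>
  define r where "r i = (if i \<le> n then f i else (c ^^ (i - n)) y)" for i
  have cpow: "(c ^^ k) y \<in> V \<and> ?d ((c ^^ k) y) = n + k" for k
    by (induction k) (use c cV assms in \<open>auto simp: n_def\<close>)
  have edge: "(r i, r (Suc i)) \<in> E" for i
  proof (cases "i < n")
    case False
    then have "r i = (c ^^ (i - n)) y" "r (Suc i) = c ((c ^^ (i - n)) y)"
      using f(2) by (auto simp: r_def Suc_diff_le)
    then show ?thesis using c cpow by metis
  qed (use f in \<open>auto simp: r_def\<close>)
  have path: "(r i, r (i + k)) \<in> E ^^ k" for i k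
    by (induction k) (use edge in auto)
  have dist: "?d (r i) = i" for i
  proof (cases "i \<le> n")
    case True
    have "(x, r i) \<in> E ^^ i" using path[of 0 i] f by (simp add: r_def)
    then have "?d (r i) \<le> i" by (rule graph_dist_le)
    \<comment> \<open>The rest of the path reaches \<open>y\<close> in \<open>n - i\<close> steps,
      and \<open>y\<close> has distance \<open>n\<close>; this forces distance at least
      \<open>i\<close> at \<open>r i\<close>.\<close>
    moreover have "graph_dist E (r i) y \<le> n - i"
      using path[of i "n - i"] True f by (intro graph_dist_le) (simp add: r_def)
    moreover have "?d y \<le> ?d (r i) + graph_dist E (r i) y"
      using assms edge[of i] tree_edges by (intro graph_dist_triangle tree_rtrancl) auto
    ultimately show ?thesis using True by (simp add: n_def)
  qed (use cpow in \<open>simp add: r_def\<close>)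
  show thesis
  proof (rule that[of r])
    show "geodesic_ray V E r"
      using assms(1) edge dist tree_edges by (intro geodesic_rayI[of x]) auto
  qed (use f in \<open>auto simp: r_def n_def\<close>)
qed

text \<open>Distance from the common starting point recovers the index along either ray, so the
  common tail occurs with equal shifts. Uniqueness of parents then carries agreement from the tail
  back to the start.\<close>

lemma same_end_imp_eq:
  assumes "(r, s) \<in> same_end V E" "r 0 = s 0"
  shows "r = s"
proof -
  obtain m n where rs: "geodesic_ray V E r" "geodesic_ray V E s"
    and mn: "\<And>k. r (m + k) = s (n + k)"
    using assms(1) by (auto simp: same_end_def)
  have d: "graph_dist E (r 0) (r i) = i" "graph_dist E (r 0) (s i) = i" for i
    using rs unfolding assms(2) geodesic_ray_def by (metis assms(2) diff_zero le0)+
  have x: "r 0 \<in> V" using rs by (auto simp: geodesic_ray_def)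
  have "m = n" using mn[of 0] d(1)[of m] d(2)[of n] by simp
  have down: "r i = s i" if "r (Suc i) = s (Suc i)" for i
  proof (rule tree_parent_unique[OF x])
    show "(r i, r (Suc i)) \<in> E" "(s i, r (Suc i)) \<in> E"
      using geodesic_ray_edge[OF rs(1), of i] geodesic_ray_edge[OF rs(2), of i] that by auto
  qed (use d in simp_all)
  show ?thesis
  proof
    fix i
    \<comment> \<open>Downward induction from \<open>m + i\<close>, an index in the common tail, to
      \<open>i\<close>.\<close>
    have "i \<le> m + i" by simp
    then show "r i = s i"
      by (induction rule: inc_induct) (use mn \<open>m = n\<close> down in auto)
  qed
qed

text \<open>The two neighbours along the line are at distance 2 from each other, hence different.
  Vertex-transitivity later spreads this from one vertex to all.\<close>

lemma geodesic_line_two_neighbours: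
  assumes "is_geodesic_line V E L" "x \<in> L"
  shows "\<exists>u w. u \<noteq> w \<and> (x, u) \<in> E \<and> (x, w) \<in> E"
proof -
  obtain l i where l: "geodesic_line V E l" and x: "x = l i"
    using assms by (auto simp: is_geodesic_line_def)
  have V: "l j \<in> V" for j using l by (auto simp: geodesic_line_def)
  have d: "graph_dist E (l j) (l k) = nat (k - j)" if "j \<le> k" for j k
    using l that by (auto simp: geodesic_line_def)
  have "(l j, l (j + 1)) \<in> E" for j
    using relpow_graph_dist[OF tree_rtrancl[OF V V], of j "j + 1"] d[of j "j + 1"] by simp
  from this[of i] this[of "i - 1"] have "(x, l (i + 1)) \<in> E" "(x, l (i - 1)) \<in> E"
    using tree_sym x by (auto dest: symD)
  moreover have "l (i + 1) \<noteq> l (i - 1)" using d[of "i - 1" "i + 1"] by auto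
  ultimately show ?thesis by blast
qed

end

section \<open>Transitivity on spheres\<close>

context graph_automorphism_action
begin

lemma relpow_action:
  assumes "E \<subseteq> V \<times> V" "g \<in> carrier G" "u \<in> V" "(u, v) \<in> E ^^ n"
  shows "(\<phi> g u, \<phi> g v) \<in> E ^^ n"
  using assms(4)
proof (induction n arbitrary: v)
  case (Suc n)
  then obtain w where "(u, w) \<in> E ^^ n" "(w, v) \<in> E" by auto
  with Suc preserves_edges[OF assms(2), of w v] assms(1) show ?case by auto
qed simp

lemma graph_dist_action:
  assumes "E \<subseteq> V \<times> V" "g \<in> carrier G" "u \<in> V" "v \<in> V"
  shows "graph_dist E (\<phi> g u) (\<phi> g v) = graph_dist E u v"
proof -
  interpret group G using group_hom group_hom.axioms(1) by blast
  have V: "\<phi> g u \<in> V" "\<phi> g v \<in> V" using element_image assms by auto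
  have inv: "\<phi> (inv g) (\<phi> g w) = w" if "w \<in> V" for w
    using orbit_sym_aux assms that by auto
  have "(\<phi> g u, \<phi> g v) \<in> E ^^ n \<longleftrightarrow> (u, v) \<in> E ^^ n" for n
    \<comment> \<open>The converse direction applies \<open>inv g\<close> to a walk between the
      images.\<close>
    using relpow_action[of g u v n] relpow_action[of "inv g" "\<phi> g u" "\<phi> g v" n]
      inv assms V by auto
  then show ?thesis by (simp add: graph_dist_def)
qed

lemma two_neighbours_action:
  assumes "E \<subseteq> V \<times> V" "transitive_action G V \<phi>" "x \<in> V" "v \<in> V"
    "\<exists>u w. u \<noteq> w \<and> (x, u) \<in> E \<and> (x, w) \<in> E"
  shows "\<exists>u w. u \<noteq> w \<and> (v, u) \<in> E \<and> (v, w) \<in> E"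
proof -
  obtain u w where uw: "u \<noteq> w" "(x, u) \<in> E" "(x, w) \<in> E" using assms(5) by blast
  obtain g where g: "g \<in> carrier G" "\<phi> g x = v"
    using transitive_action.unique_orbit[OF assms(2-4)] by blast
  have "(\<phi> g x, \<phi> g u) \<in> E" "(\<phi> g x, \<phi> g w) \<in> E" "\<phi> g u \<noteq> \<phi> g w"
    using uw preserves_edges[OF g(1)] inj_prop[OF g(1)] assms(1) by (auto dest: inj_onD)
  then show ?thesis using g by auto
qed

lemma stabilizer_transitive_on_spheres:
  assumes "tree V E" "x \<in> V" "y \<in> V" "z \<in> V"
    and "\<And>v. v \<in> V \<Longrightarrow> \<exists>u w. u \<noteq> w \<and> (v, u) \<in> E \<and> (v, w) \<in> E"
    and "transitive_on_boundary V E (stabilizer G \<phi> x) \<phi>"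
    and "graph_dist E x y = graph_dist E x z"
  shows "\<exists>k\<in>stabilizer G \<phi> x. \<phi> k y = z"
proof -
  obtain r where r: "geodesic_ray V E r" "r 0 = x" "r (graph_dist E x y) = y"
    using geodesic_ray_through assms(1-3,5) by metis
  obtain s where s: "geodesic_ray V E s" "s 0 = x" "s (graph_dist E x z) = z"
    using geodesic_ray_through assms(1,2,4,5) by metis
  have "same_end V E `` {r} \<in> visual_boundary V E" "same_end V E `` {s} \<in> visual_boundary V E"
    using r s by (auto simp: visual_boundary_def quotient_def)
  then obtain k where k: "k \<in> stabilizer G \<phi> x"
    "boundary_map (\<phi> k) (same_end V E `` {r}) = same_end V E `` {s}"
    using assms(6) unfolding transitive_on_boundary_def by blast
  \<comment> \<open>\<open>boundary_map\<close> is an image of a whole class, so the translate of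
    the representative \<open>r\<close> itself lies in the class of \<open>s\<close>.\<close>
  have "r \<in> same_end V E `` {r}" using r by (auto simp: same_end_def)
  then have "(s, \<phi> k \<circ> r) \<in> same_end V E" using k(2) by (auto simp: boundary_map_def)
  moreover have "s 0 = (\<phi> k \<circ> r) 0" using r s k by (simp add: stabilizer_def)
  ultimately have "s = \<phi> k \<circ> r" by (rule same_end_imp_eq[OF assms(1)])
  then show ?thesis using r s k assms(7) by (metis comp_apply)
qed

text \<open>Stated with \<open>g \<otimes> k \<otimes> g\<close> instead of an equation for
  \<open>inv g\<close>, because membership of such a product in \<open>K\<close> can be lifted to
  the extension through the first coordinate.\<close>

lemma inverse_in_double_coset:
  assumes "tree V E" "x \<in> V" "g \<in> carrier G"
    and "\<And>v. v \<in> V \<Longrightarrow> \<exists>u w. u \<noteq> w \<and> (v, u) \<in> E \<and> (v, w) \<in> E"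
    and "transitive_on_boundary V E (stabilizer G \<phi> x) \<phi>"
  shows "\<exists>k\<in>stabilizer G \<phi> x. g \<otimes> k \<otimes> g \<in> stabilizer G \<phi> x"
proof -
  interpret group G using group_hom group_hom.axioms(1) by blast
  have V: "\<phi> g x \<in> V" "\<phi> (inv g) x \<in> V"
    using element_image assms(2,3) inv_closed by blast+
  have gg: "\<phi> g (\<phi> (inv g) x) = x"
    using orbit_sym_aux[of "inv g" x] assms(2,3) by auto
  \<comment> \<open>Apply \<open>g\<close> to the pair of vertices \<open>\<phi> (inv g) x\<close>
    and \<open>x\<close>: it becomes \<open>x\<close> and \<open>\<phi> g x\<close>.\<close>
  have "graph_dist E x (\<phi> g x) = graph_dist E (\<phi> g (\<phi> (inv g) x)) (\<phi> g x)"
    by (simp add: gg)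
  also have "\<dots> = graph_dist E x (\<phi> (inv g) x)"
    using graph_dist_action[OF tree_edges[OF assms(1)] assms(3) V(2) assms(2)]
      graph_dist_commute[OF tree_sym[OF assms(1)]] by metis
  finally obtain k where k: "k \<in> stabilizer G \<phi> x" "\<phi> k (\<phi> g x) = \<phi> (inv g) x"
    using stabilizer_transitive_on_spheres assms V by metis
  have kc: "k \<in> carrier G" using k by (simp add: stabilizer_def)
  have "\<phi> (g \<otimes> k \<otimes> g) x = x"
    using composition_rule[of x "g \<otimes> k" g] composition_rule[of "\<phi> g x" g k] k gg kc assms V
    by simp
  then show ?thesis using k kc assms by (auto simp: stabilizer_def)
qed

end

section \<open>Gelfand's trick\<close>

context topological_group
begin

lemma continuous_translation:
  assumes "h \<in> carrier G"
  shows "continuous_map \<tau> \<tau> (\<lambda>g. h \<otimes> g)"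
proof -
  have "continuous_map \<tau> (prod_topology \<tau> \<tau>) (\<lambda>g. (h, g))"
    using assms by (auto intro!: continuous_map_pairedI simp: topspace_eq)
  from continuous_map_compose[OF this continuous_mult] show ?thesis
    by (simp add: comp_def)
qed

section \<open>Integration and convolution for a left Haar measure\<close>

context
  fixes \<mu> :: "'a measure"
  assumes haar: "left_haar_measure G \<tau> \<mu>"
begin

lemma haar_sets: "sets \<mu> = sigma_sets (topspace \<tau>) {U. openin \<tau> U}"
proof -
  have "{U. openin \<tau> U} \<subseteq> Pow (topspace \<tau>)" by (auto dest: openin_subset)
  then show ?thesis using haar by (simp add: left_haar_measure_def)
qed

lemma haar_space: "space \<mu> = carrier G"
proof -
  have "sets \<mu> = sets (sigma (topspace \<tau>) {U. openin \<tau> U})"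
    using haar by (simp add: left_haar_measure_def)
  from sets_eq_imp_space_eq[OF this] have "space \<mu> = topspace \<tau>"
    by (subst (asm) space_measure_of) (auto dest: openin_subset)
  then show ?thesis by (simp add: topspace_eq)
qed

lemma open_in_haar_sets: "openin \<tau> U \<Longrightarrow> U \<in> sets \<mu>"
  by (simp add: haar_sets)

lemma continuous_imp_haar_measurable:
  fixes f :: "'a \<Rightarrow> complex"
  assumes "continuous_map \<tau> euclidean f"
  shows "f \<in> borel_measurable \<mu>"
proof (rule borel_measurableI)
  fix S :: "complex set"
  assume "open S"
  then have "openin \<tau> {x \<in> topspace \<tau>. f x \<in> S}"
    using assms by (auto simp: continuous_map_def)
  moreover have "{x \<in> topspace \<tau>. f x \<in> S} = f -` S \<inter> space \<mu>"
    by (auto simp: haar_space topspace_eq)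
  ultimately show "f -` S \<inter> space \<mu> \<in> sets \<mu>" by (metis open_in_haar_sets)
qed

lemma continuous_endomap_haar_measurable:
  assumes "continuous_map \<tau> \<tau> f"
  shows "f \<in> measurable \<mu> \<mu>"
proof (rule measurable_sigma_sets[OF haar_sets])
  show "f \<in> space \<mu> \<rightarrow> topspace \<tau>"
    using assms by (auto simp: continuous_map_def haar_space topspace_eq)
  fix U
  assume "U \<in> {U. openin \<tau> U}"
  then have "openin \<tau> {x \<in> topspace \<tau>. f x \<in> U}"
    using assms by (auto simp: continuous_map_def)
  moreover have "{x \<in> topspace \<tau>. f x \<in> U} = f -` U \<inter> space \<mu>"
    by (auto simp: haar_space topspace_eq)
  ultimately show "f -` U \<inter> space \<mu> \<in> sets \<mu>" by (metis open_in_haar_sets)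
qed (auto dest: openin_subset)

text \<open>The preimage of \<open>A\<close> under translation by \<open>h\<close> is the coset
  \<open>inv h <# A\<close>, to which left invariance applies.\<close>

lemma haar_distr_translation:
  assumes "h \<in> carrier G"
  shows "distr \<mu> \<mu> (\<lambda>g. h \<otimes> g) = \<mu>"
proof (rule measure_eqI)
  fix A
  assume "A \<in> sets (distr \<mu> \<mu> (\<lambda>g. h \<otimes> g))"
  then have A: "A \<in> sets \<mu>" by simp
  then have sub: "A \<subseteq> carrier G" using sets.sets_into_space haar_space by blast
  have "(\<lambda>g. h \<otimes> g) -` A \<inter> space \<mu> = inv h <# A"
  proof (intro equalityI subsetI)
    fix g
    assume "g \<in> (\<lambda>g. h \<otimes> g) -` A \<inter> space \<mu>"
    then have "h \<otimes> g \<in> A" "g = inv h \<otimes> (h \<otimes> g)"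
      using assms by (auto simp: haar_space m_assoc[symmetric])
    then show "g \<in> inv h <# A" by (auto simp: l_coset_def)
  next
    fix g
    assume "g \<in> inv h <# A"
    then show "g \<in> (\<lambda>g. h \<otimes> g) -` A \<inter> space \<mu>"
      using assms sub by (auto simp: haar_space l_coset_def m_assoc[symmetric])
  qed
  then show "emeasure (distr \<mu> \<mu> (\<lambda>g. h \<otimes> g)) A = emeasure \<mu> A"
    using haar A assms continuous_endomap_haar_measurable[OF continuous_translation[OF assms]]
    by (simp add: emeasure_distr left_haar_measure_def)
qed simp

text \<open>\<open>integral_distr\<close> asks for measurability alone, so functions that are not
  integrable, with Bochner integral 0, are covered too.\<close>

lemma haar_integral_translation:
  fixes f :: "'a \<Rightarrow> complex"
  assumes "h \<in> carrier G" "f \<in> borel_measurable \<mu>"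
  shows "(\<integral>g. f (h \<otimes> g) \<partial>\<mu>) = (\<integral>g. f g \<partial>\<mu>)"
  using integral_distr[OF continuous_endomap_haar_measurable[OF continuous_translation], of h f]
    assms haar_distr_translation by simp

lemma hecke_algebra_convolution_measurable:
  assumes "\<psi> \<in> hecke_algebra G \<tau> C" "\<phi> \<in> hecke_algebra G \<tau> C" "x \<in> carrier G"
  shows "(\<lambda>g. \<psi> (x \<otimes> g) * \<phi> (inv g)) \<in> borel_measurable \<mu>"
proof (intro borel_measurable_times)
  have "continuous_map \<tau> euclidean \<psi>" "continuous_map \<tau> euclidean \<phi>"
    using assms by (auto simp: hecke_algebra_def)
  then show "(\<lambda>g. \<psi> (x \<otimes> g)) \<in> borel_measurable \<mu>" "(\<lambda>g. \<phi> (inv g)) \<in> borel_measurable \<mu>"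
    using continuous_map_compose[OF continuous_translation[OF assms(3)]]
      continuous_map_compose[OF continuous_inv]
    by (auto intro!: continuous_imp_haar_measurable simp: comp_def)
qed

text \<open>The factor \<open>c\<close> is absorbed by left invariance of \<open>\<psi>\<close>. The
  factor \<open>c'\<close> goes into the integration variable: replacing \<open>g\<close> by
  \<open>c' \<otimes> g\<close> leaves \<open>\<phi> (inv g)\<close> unchanged, by right invariance
  of \<open>\<phi>\<close>, and left invariance of the measure removes it.\<close>

lemma convolution_bi_invariant:
  assumes "subgroup C G" "\<psi> \<in> hecke_algebra G \<tau> C" "\<phi> \<in> hecke_algebra G \<tau> C"
    "x \<in> carrier G" "c \<in> C" "c' \<in> C"
  shows "convolution G \<mu> \<psi> \<phi> (c \<otimes> x \<otimes> c') = convolution G \<mu> \<psi> \<phi> x"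
proof -
  have C: "c \<in> carrier G" "c' \<in> carrier G" "inv c' \<in> carrier G" "\<one> \<in> C" "inv c' \<in> C"
    using assms(1,5,6) by (auto simp: subgroup.mem_carrier subgroup.one_closed subgroup.m_inv_closed)
  have \<psi>: "\<psi> (a \<otimes> g \<otimes> b) = \<psi> g" and \<phi>: "\<phi> (a \<otimes> g \<otimes> b) = \<phi> g"
    if "a \<in> C" "b \<in> C" "g \<in> carrier G" for a b g
    using assms(2,3) that by (auto simp: hecke_algebra_def)
  have "\<psi> (c \<otimes> x \<otimes> c' \<otimes> g) * \<phi> (inv g) = \<psi> (x \<otimes> (c' \<otimes> g)) * \<phi> (inv (c' \<otimes> g))"
    if g: "g \<in> carrier G" for g
  proof -
    have "\<psi> (c \<otimes> x \<otimes> c' \<otimes> g) = \<psi> (x \<otimes> (c' \<otimes> g))"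
      using \<psi>[of c \<one> "x \<otimes> (c' \<otimes> g)"] g C assms by (simp add: m_assoc)
    moreover have "\<phi> (inv (c' \<otimes> g)) = \<phi> (inv g)"
      using \<phi>[of \<one> "inv c'" "inv g"] g C by (simp add: inv_mult_group)
    ultimately show ?thesis by simp
  qed
  then have "(\<integral>g. \<psi> (c \<otimes> x \<otimes> c' \<otimes> g) * \<phi> (inv g) \<partial>\<mu>)
      = (\<integral>g. \<psi> (x \<otimes> (c' \<otimes> g)) * \<phi> (inv (c' \<otimes> g)) \<partial>\<mu>)"
    by (intro Bochner_Integration.integral_cong) (auto simp: haar_space)
  also have "\<dots> = (\<integral>g. \<psi> (x \<otimes> g) * \<phi> (inv g) \<partial>\<mu>)"
    using haar_integral_translation[OF C(2) hecke_algebra_convolution_measurable] assms by blast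
  finally show ?thesis using assms C by (simp add: convolution_def)
qed

text \<open>
  The left translation by \<open>x\<close> turns \<open>\<psi> * \<phi>\<close> at \<open>x\<close> into \<open>\<phi> * \<psi>\<close> at \<open>inv x\<close>, which lies in the
  double coset of \<open>x\<close>.
\<close>

lemma convolution_commute:
  assumes "subgroup C G" "\<And>g. g \<in> carrier G \<Longrightarrow> \<exists>c\<in>C. \<exists>c'\<in>C. inv g = c \<otimes> g \<otimes> c'"
    "\<psi> \<in> hecke_algebra G \<tau> C" "\<phi> \<in> hecke_algebra G \<tau> C"
  shows "convolution G \<mu> \<psi> \<phi> = convolution G \<mu> \<phi> \<psi>"
proof
  fix x
  show "convolution G \<mu> \<psi> \<phi> x = convolution G \<mu> \<phi> \<psi> x"
  proof (cases "x \<in> carrier G")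
    case x: True
    \<comment> \<open>Bi-invariant functions are constant on double cosets, and each double coset is
      closed under inversion.\<close>
    have inv_eq: "f (inv g) = f g" if "f \<in> hecke_algebra G \<tau> C" "g \<in> carrier G" for f g
      using assms(2)[OF that(2)] that by (auto simp: hecke_algebra_def)
    obtain c c' where c: "c \<in> C" "c' \<in> C" "inv x = c \<otimes> x \<otimes> c'" using assms(2) x by blast
    have "convolution G \<mu> \<phi> \<psi> x = convolution G \<mu> \<phi> \<psi> (inv x)"
      using convolution_bi_invariant[OF assms(1,4,3) x c(1,2)] c(3) by simp
    also have "\<dots> = (\<integral>g. \<phi> (inv x \<otimes> g) * \<psi> (inv g) \<partial>\<mu>)"
      using x by (simp add: convolution_def)
    also have "\<dots> = (\<integral>g. \<phi> (inv x \<otimes> (x \<otimes> g)) * \<psi> (inv (x \<otimes> g)) \<partial>\<mu>)"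
      using haar_integral_translation[OF x hecke_algebra_convolution_measurable[OF assms(4,3)],
        of "inv x"] x by simp
    \<comment> \<open>After cancelling \<open>x\<close>, the integrand is
      \<open>\<phi> g * \<psi> (inv (x \<otimes> g))\<close>; \<open>inv_eq\<close> is applied to
      both factors.\<close>
    also have "\<dots> = (\<integral>g. \<psi> (x \<otimes> g) * \<phi> (inv g) \<partial>\<mu>)"
      using x inv_eq[OF assms(3)] inv_eq[OF assms(4)]
      by (intro Bochner_Integration.integral_cong) (auto simp: haar_space m_assoc[symmetric])
    finally show ?thesis using x by (simp add: convolution_def)
  qed (simp add: convolution_def)
qed

end

end

lemma gelfand_pairI:
  assumes "locally_compact_group G \<tau>" "subgroup C G" "compactin \<tau> C"
    and "\<And>g. g \<in> carrier G \<Longrightarrow> \<exists>c\<in>C. \<exists>c'\<in>C. inv\<^bsub>G\<^esub> g = c \<otimes>\<^bsub>G\<^esub> g \<otimes>\<^bsub>G\<^esub> c'"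
  shows "gelfand_pair G \<tau> C"
proof -
  interpret locally_compact_group G \<tau> by fact
  show ?thesis unfolding gelfand_pair_def using assms convolution_commute by blast
qed

text \<open>Turns membership of \<open>h \<otimes> c \<otimes> h\<close> in a subgroup containing
  \<open>c\<close> into membership of \<open>inv h\<close> in the double coset of
  \<open>h\<close>.\<close>

lemma (in group) inv_eq_mult_inv:
  assumes "c \<in> carrier G" "h \<in> carrier G"
  shows "inv h = c \<otimes> h \<otimes> inv (h \<otimes> c \<otimes> h)"
proof -
  have "inv (h \<otimes> c \<otimes> h) = inv (c \<otimes> h) \<otimes> inv h"
    using assms inv_mult_group[of h "c \<otimes> h"] m_assoc[of h c h] by simp
  then show ?thesis
    using assms m_assoc[of "c \<otimes> h" "inv (c \<otimes> h)" "inv h"] by simp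
qed

section \<open>Central extensions\<close>

lemma carrier_cocycle_extension [simp]:
  "carrier (cocycle_extension G T \<alpha>) = carrier G \<times> carrier T"
  by (simp add: cocycle_extension_def)

lemma one_cocycle_extension [simp]:
  "\<one>\<^bsub>cocycle_extension G T \<alpha>\<^esub> = (\<one>\<^bsub>G\<^esub>, \<one>\<^bsub>T\<^esub>)"
  by (simp add: cocycle_extension_def)

lemma mult_cocycle_extension [simp]:
  "(g, t) \<otimes>\<^bsub>cocycle_extension G T \<alpha>\<^esub> (h, s) = (g \<otimes>\<^bsub>G\<^esub> h, \<alpha> g h \<otimes>\<^bsub>T\<^esub> t \<otimes>\<^bsub>T\<^esub> s)"
  by (simp add: cocycle_extension_def)

context
  fixes G :: "'g monoid" and T :: "'t monoid" and \<alpha> :: "'g \<Rightarrow> 'g \<Rightarrow> 't"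
  assumes group_G: "group G" and group_ext: "group (cocycle_extension G T \<alpha>)"
begin

interpretation G: group G by (rule group_G)
interpretation ext: group "cocycle_extension G T \<alpha>" by (rule group_ext)

lemma fst_hom_cocycle_extension: "fst \<in> hom (cocycle_extension G T \<alpha>) G"
  by (auto simp: hom_def)

lemma fst_inv_cocycle_extension:
  assumes "h \<in> carrier (cocycle_extension G T \<alpha>)"
  shows "fst (inv\<^bsub>cocycle_extension G T \<alpha>\<^esub> h) = inv\<^bsub>G\<^esub> (fst h)"
proof -
  interpret group_hom "cocycle_extension G T \<alpha>" G fst
    by unfold_locales (rule fst_hom_cocycle_extension)
  show ?thesis using assms by (rule hom_inv)
qed

text \<open>Within the extension, membership in \<open>K \<times> carrier T\<close> depends on the
  first coordinate only, and \<open>fst\<close> is a homomorphism.\<close>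

lemma subgroup_cocycle_extension:
  assumes "subgroup K G"
  shows "subgroup (K \<times> carrier T) (cocycle_extension G T \<alpha>)"
proof (rule ext.subgroupI)
  show "K \<times> carrier T \<subseteq> carrier (cocycle_extension G T \<alpha>)"
    using subgroup.subset[OF assms] by auto
  show "K \<times> carrier T \<noteq> {}"
    using subgroup.one_closed[OF assms] ext.one_closed by auto
next
  fix h
  assume h: "h \<in> K \<times> carrier T"
  then have hc: "h \<in> carrier (cocycle_extension G T \<alpha>)" using subgroup.subset[OF assms] by auto
  have "fst (inv\<^bsub>cocycle_extension G T \<alpha>\<^esub> h) \<in> K"
    using fst_inv_cocycle_extension[OF hc] h subgroup.m_inv_closed[OF assms] by auto
  with ext.inv_closed[OF hc] show "inv\<^bsub>cocycle_extension G T \<alpha>\<^esub> h \<in> K \<times> carrier T"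
    by (auto simp: mem_Times_iff)
  fix h'
  assume h': "h' \<in> K \<times> carrier T"
  then have "h' \<in> carrier (cocycle_extension G T \<alpha>)" using subgroup.subset[OF assms] by auto
  from ext.m_closed[OF hc this] show "h \<otimes>\<^bsub>cocycle_extension G T \<alpha>\<^esub> h' \<in> K \<times> carrier T"
    using h h' subgroup.m_closed[OF assms] by auto
qed

lemma inverse_in_double_coset_extension:
  assumes K: "subgroup K G" and h: "h \<in> carrier (cocycle_extension G T \<alpha>)"
    and k: "k \<in> K" "fst h \<otimes>\<^bsub>G\<^esub> k \<otimes>\<^bsub>G\<^esub> fst h \<in> K"
  shows "\<exists>c\<in>K \<times> carrier T. \<exists>c'\<in>K \<times> carrier T.
    inv\<^bsub>cocycle_extension G T \<alpha>\<^esub> h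
      = c \<otimes>\<^bsub>cocycle_extension G T \<alpha>\<^esub> h \<otimes>\<^bsub>cocycle_extension G T \<alpha>\<^esub> c'"
proof -
  let ?H = "cocycle_extension G T \<alpha>"
  \<comment> \<open>A lift of \<open>k\<close>; that the unit of \<open>T\<close> lies in its
    carrier is read off from \<open>ext.one_closed\<close>.\<close>
  define c where "c = (k, \<one>\<^bsub>T\<^esub>)"
  have c: "c \<in> K \<times> carrier T" "c \<in> carrier ?H"
    using k subgroup.mem_carrier[OF K] ext.one_closed by (auto simp: c_def)
  define d where "d = h \<otimes>\<^bsub>?H\<^esub> c \<otimes>\<^bsub>?H\<^esub> h"
  have "fst d = fst h \<otimes>\<^bsub>G\<^esub> k \<otimes>\<^bsub>G\<^esub> fst h"
    by (cases h) (simp add: d_def c_def)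
  \<comment> \<open>The second coordinate of \<open>d\<close> involves values of
    \<open>\<alpha>\<close>, but only that it lies in \<open>T\<close> matters.\<close>
  moreover have "d \<in> carrier ?H" using c h by (simp only: d_def ext.m_closed)
  ultimately have d: "d \<in> K \<times> carrier T" "d \<in> carrier ?H"
    using k by (auto simp: mem_Times_iff)
  have "inv\<^bsub>?H\<^esub> h = c \<otimes>\<^bsub>?H\<^esub> h \<otimes>\<^bsub>?H\<^esub> inv\<^bsub>?H\<^esub> d"
    unfolding d_def using c(2) h by (rule ext.inv_eq_mult_inv)
  moreover have "inv\<^bsub>?H\<^esub> d \<in> K \<times> carrier T"
    using subgroup.m_inv_closed[OF subgroup_cocycle_extension[OF K] d(1)] .
  ultimately show ?thesis using c(1) by (intro bexI)
qed

end

text \<open>The set is a finite union of slices, one for each \<open>t\<close> in \<open>T\<close>,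
  each the image of \<open>K\<close> under \<open>k\<close> to \<open>(k, t)\<close>. These maps are
  continuous since \<open>\<alpha>\<close> is trivial on \<open>K\<close>, so that right
  multiplication by \<open>U \<times> {1}\<close> moves \<open>(k, t)\<close> within its
  slice.\<close>

lemma compactin_cocycle_extension:
  assumes "topological_group G \<tau>" "topological_group (cocycle_extension G T \<alpha>) \<tau>'"
    and "group T" "finite (carrier T)"
    and "subgroup K G" "compactin \<tau> K" "\<forall>k\<in>K. \<forall>k'\<in>K. \<alpha> k k' = \<one>\<^bsub>T\<^esub>"
    and basis: "neighbourhood_basis \<tau>' (\<one>\<^bsub>G\<^esub>, \<one>\<^bsub>T\<^esub>)
      {U \<times> {\<one>\<^bsub>T\<^esub>} | U. U \<in> compact_open_subgroups G \<tau> \<and> U \<subseteq> K}"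
  shows "compactin \<tau>' (K \<times> carrier T)"
proof -
  interpret G: topological_group G \<tau> by fact
  interpret ext: topological_group "cocycle_extension G T \<alpha>" \<tau>' by fact
  interpret T: group T by fact
  interpret K: subgroup K G by fact
  let ?H = "cocycle_extension G T \<alpha>"
  have "continuous_map (subtopology \<tau> K) \<tau>' (\<lambda>k. (k, t))" if t: "t \<in> carrier T" for t
    unfolding continuous_map_def
  proof (intro conjI allI impI)
    have top: "topspace (subtopology \<tau> K) = K"
      using K.subset by (auto simp: topspace_subtopology G.topspace_eq)
    show "(\<lambda>k. (k, t)) \<in> topspace (subtopology \<tau> K) \<rightarrow> topspace \<tau>'"
      using t K.subset by (auto simp: top ext.topspace_eq)
    fix W
    assume W: "openin \<tau>' W"
    have "\<exists>N. openin (subtopology \<tau> K) N \<and> k \<in> N \<and> N \<subseteq> {k \<in> K. (k, t) \<in> W}"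
      if k: "k \<in> K" "(k, t) \<in> W" for k
    proof -
      have kt: "(k, t) \<in> carrier ?H" using k t by auto
      \<comment> \<open>Translate \<open>W\<close> back to the identity, where the given basis
        applies.\<close>
      define W' where "W' = {h \<in> topspace \<tau>'. (k, t) \<otimes>\<^bsub>?H\<^esub> h \<in> W}"
      have "openin \<tau>' W'"
        unfolding W'_def using ext.continuous_translation[OF kt] W by (rule openin_continuous_map_preimage)
      moreover have "(\<one>\<^bsub>G\<^esub>, \<one>\<^bsub>T\<^esub>) \<in> W'"
        using k ext.r_one[OF kt] ext.one_closed by (simp add: W'_def ext.topspace_eq)
      moreover have "neighbourhood_base_at (\<one>\<^bsub>G\<^esub>, \<one>\<^bsub>T\<^esub>)
          (\<lambda>B. \<exists>U. B = U \<times> {\<one>\<^bsub>T\<^esub>} \<and> U \<in> compact_open_subgroups G \<tau> \<and> U \<subseteq> K) \<tau>'"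
        using basis by (simp add: neighbourhood_basis_def)
      ultimately obtain U where U: "U \<in> compact_open_subgroups G \<tau>" "U \<subseteq> K" "U \<times> {\<one>\<^bsub>T\<^esub>} \<subseteq> W'"
        unfolding neighbourhood_base_at_def by metis
      \<comment> \<open>This is the coset of \<open>U\<close> through \<open>k\<close>, written as a
        preimage to make openness visible.\<close>
      define N where "N = {y \<in> topspace \<tau>. inv\<^bsub>G\<^esub> k \<otimes>\<^bsub>G\<^esub> y \<in> U}"
      have "openin \<tau> N"
        unfolding N_def
        by (rule openin_continuous_map_preimage[OF G.continuous_translation])
          (use k U in \<open>auto simp: compact_open_subgroups_def\<close>)
      moreover have "k \<in> N"
        using k U(1) by (auto simp: N_def G.topspace_eq compact_open_subgroups_def subgroup.one_closed)
      moreover have "(y, t) \<in> W \<and> y \<in> K" if "y \<in> N" for y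
      proof -
        define u where "u = inv\<^bsub>G\<^esub> k \<otimes>\<^bsub>G\<^esub> y"
        have u: "u \<in> U" "u \<in> K" and y: "y \<in> carrier G"
          using that U(2) by (auto simp: N_def u_def G.topspace_eq)
        have yk: "y = k \<otimes>\<^bsub>G\<^esub> u"
          using k y by (simp add: u_def G.m_assoc[symmetric])
        \<comment> \<open>Both \<open>k\<close> and \<open>u\<close> lie in \<open>K\<close>, so the
          cocycle contributes the unit.\<close>
        have "(k, t) \<otimes>\<^bsub>?H\<^esub> (u, \<one>\<^bsub>T\<^esub>) = (y, t)"
          using k u t assms(7) by (simp add: yk)
        moreover have "(u, \<one>\<^bsub>T\<^esub>) \<in> W'" using U(3) u by auto
        ultimately show ?thesis using yk k u by (auto simp: W'_def)
      qed
      ultimately show ?thesis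
        using k by (intro exI[of _ "N \<inter> K"]) (auto simp: openin_subtopology)
    qed
    then show "openin (subtopology \<tau> K) {k \<in> topspace (subtopology \<tau> K). (k, t) \<in> W}"
      unfolding top by (subst openin_subopen) blast
  qed
  then have "compactin \<tau>' ((\<lambda>k. (k, t)) ` K)" if "t \<in> carrier T" for t
    using that assms(6) by (intro image_compactin[of "subtopology \<tau> K"])
      (auto simp: compactin_subtopology)
  then have "compactin \<tau>' (\<Union>t\<in>carrier T. (\<lambda>k. (k, t)) ` K)"
    using assms(4) by (intro compactin_Union) auto
  moreover have "(\<Union>t\<in>carrier T. (\<lambda>k. (k, t)) ` K) = K \<times> carrier T" by auto
  ultimately show ?thesis by simp
qed

theorem theorem1p2:
  fixes G :: "'g monoid" and \<tau> :: "'g topology"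
    and V :: "'v set" and E :: "('v \<times> 'v) set" and \<phi> :: "'g \<Rightarrow> 'v \<Rightarrow> 'v"
    and L :: "'v set" and x :: 'v and K :: "'g set"
    and T :: "'t monoid" and \<alpha> :: "'g \<Rightarrow> 'g \<Rightarrow> 't" and \<tau>' :: "('g \<times> 't) topology"
    and a :: 'g
  assumes "locally_compact_group G \<tau>"
    and "tree V E" and "locally_finite_graph V E" and "infinite V"
    and "graph_automorphism_action G V E \<phi>" and "transitive_action G V \<phi>"
    and "is_geodesic_line V E L" and "x \<in> L"
    and "K = stabilizer G \<phi> x"
    and "compactin \<tau> K" and "openin \<tau> K"
    and "neighbourhood_basis \<tau> \<one>\<^bsub>G\<^esub> {U \<in> compact_open_subgroups G \<tau>. U \<subseteq> K}"
    and "comm_group T" and "finite (carrier T)"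
    and "normalized_2_cocycle G T \<alpha>" and "\<forall>k\<in>K. \<forall>k'\<in>K. \<alpha> k k' = \<one>\<^bsub>T\<^esub>"
    and "locally_compact_group (cocycle_extension G T \<alpha>) \<tau>'"
    and "neighbourhood_basis \<tau>' (\<one>\<^bsub>G\<^esub>, \<one>\<^bsub>T\<^esub>)
           {U \<times> {\<one>\<^bsub>T\<^esub>} | U. U \<in> compact_open_subgroups G \<tau> \<and> U \<subseteq> K}"
    and "transitive_on_boundary V E K \<phi>"
    and "a \<in> carrier G" and "\<phi> a ` L = L" and "translates_line V E (\<phi> a) L 1"
  shows "gelfand_pair (cocycle_extension G T \<alpha>) \<tau>' (K \<times> carrier T)"
proof -
  interpret G: locally_compact_group G \<tau> by fact
  interpret ext: locally_compact_group "cocycle_extension G T \<alpha>" \<tau>' by fact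
  interpret graph_automorphism_action G V E \<phi> by fact
  interpret T: comm_group T by fact
  have E: "E \<subseteq> V \<times> V" using tree_edges assms(2) .
  have x: "x \<in> V"
    using assms(7,8) by (auto simp: is_geodesic_line_def geodesic_line_def)
  have K: "subgroup K G" using stabilizer_subgroup[OF x] assms(9) by simp
  \<comment> \<open>The line provides two neighbours at \<open>x\<close>, and vertex-transitivity
    carries them to every \<open>v\<close>.\<close>
  have branch: "\<exists>u w. u \<noteq> w \<and> (v, u) \<in> E \<and> (v, w) \<in> E" if "v \<in> V" for v
    using two_neighbours_action[OF E assms(6) x that]
      geodesic_line_two_neighbours[OF assms(2,7,8)] by blast
  show ?thesis
  proof (rule gelfand_pairI)
    show "subgroup (K \<times> carrier T) (cocycle_extension G T \<alpha>)"
      using subgroup_cocycle_extension G.group_axioms ext.group_axioms K by blast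
    show "compactin \<tau>' (K \<times> carrier T)"
      using compactin_cocycle_extension[OF G.topological_group_axioms ext.topological_group_axioms
          T.group_axioms assms(14) K assms(10,16,18)] .
    fix h
    assume h: "h \<in> carrier (cocycle_extension G T \<alpha>)"
    then have "fst h \<in> carrier G" by auto
    \<comment> \<open>The double coset condition is solved in \<open>G\<close> for the first
      coordinate and then lifted.\<close>
    then obtain k where "k \<in> K" "fst h \<otimes>\<^bsub>G\<^esub> k \<otimes>\<^bsub>G\<^esub> fst h \<in> K"
      using inverse_in_double_coset[OF assms(2) x _ branch] assms(9,19) by blast
    then show "\<exists>c\<in>K \<times> carrier T. \<exists>c'\<in>K \<times> carrier T.
      inv\<^bsub>cocycle_extension G T \<alpha>\<^esub> h
        = c \<otimes>\<^bsub>cocycle_extension G T \<alpha>\<^esub> h \<otimes>\<^bsub>cocycle_extension G T \<alpha>\<^esub> c'"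
      by (rule inverse_in_double_coset_extension[OF G.group_axioms ext.group_axioms K h])
  qed fact
qed

end
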